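(* (Compactness theorem) Let $V\subseteq[0,1]$ be a Gödel set such that $(V,d_{max})$ is a compact Hausdorff space. In the first-order Gödel logic $\mathfrak{G}_V$, every finitely satisfiable theory is satisfiable.
   Context: $d_{max}$ denotes the metric on $[0,1]$ given by $d_{max}(x,y)=\max\{x,y\}$ if $x\ne y$ and $d_{max}(x,x)=0$. A Gödel set is a subset $V\subseteq[0,1]$ with $0,1\in V$, used as a set of truth values with $0$ meaning absolute truth (e.g. $V=\{1/n:n\in\mathbb{N}\}\cup\{0\}$). The first-order Gödel logic $\mathfrak{G}_V$ in the metric semantic: for a first-order language $\mathcal{L}$, an $\mathcal{L}$-structure $\mathcal{M}$ is a nonempty set $M$ with functions $f^{\mathcal{M}}:M^n\to M$ and predicates $R^{\mathcal{M}}:M^n\to V$; formulas built from atoms, $\bot$, $\&$, $\to$, $\wedge$, $\forall$, $\exists$ are interpreted by $\bot^{\mathcal{M}}=1$, $(\varphi\&\psi)^{\mathcal{M}}=(\varphi\wedge\psi)^{\mathcal{M}}=\max\{\varphi^{\mathcal{M}},\psi^{\mathcal{M}}\}$, $(\varphi\to\psi)^{\mathcal{M}}=0$ if $\varphi^{\mathcal{M}}\ge\psi^{\mathcal{M}}$ and $=\psi^{\mathcal{M}}$ otherwise, $(\forall y\,\psi)^{\mathcal{M}}(\bar a)=\sup_{b\in M}\psi^{\mathcal{M}}(b,\bar a)$, $(\exists y\,\psi)^{\mathcal{M}}(\bar a)=\inf_{b\in M}\psi^{\mathcal{M}}(b,\bar a)$. A structure $\mathcal{M}$ satisfies a sentence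 $\varphi$ if $\varphi^{\mathcal{M}}=0$; a theory (set of sentences) is satisfiable if some structure satisfies all its sentences, and finitely satisfiable if every finite subset is satisfiable. *)

theory Defs
  imports "HOL-Analysis.Abstract_Metric_Spaces"
begin

text \<open>The library's locale \<open>Metric_space\<close> requires a distance that is nonnegative on
  the whole type; the absolute values only serve this purpose and have no effect on \<open>[0,1]\<close>.\<close>

definition dmax :: "real \<Rightarrow> real \<Rightarrow> real" where
  "dmax x y = (if x = y then 0 else max \<bar>x\<bar> \<bar>y\<bar>)"

lemma dmax_unit_interval:
  "x \<in> {0..1} \<Longrightarrow> y \<in> {0..1} \<Longrightarrow> dmax x y = (if x = y then 0 else max x y)"
  by (simp add: dmax_def)

definition godel_set :: "real set \<Rightarrow> bool" where
  "godel_set V \<longleftrightarrow> V \<subseteq> {0..1} \<and> 0 \<in> V \<and> 1 \<in> V"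

lemma Metric_space_dmax: "Metric_space V dmax"
  by unfold_locales (auto simp: dmax_def max_def)

abbreviation dmax_topology :: "real set \<Rightarrow> real topology" where
  "dmax_topology V \<equiv> Metric_space.mtopology V dmax"

text \<open>The symbols of a language are subsets of the types \<open>'f\<close> and \<open>'p\<close>, so that
  a language may have no function symbols (or no predicate symbols) at all.
  There is no equality symbol.\<close>

record ('f, 'p) lang =
  fsyms :: "'f set"
  psyms :: "'p set"
  farity :: "'f \<Rightarrow> nat"
  parity :: "'p \<Rightarrow> nat"

datatype 'f tm = Var nat | Fun 'f "'f tm list"

text \<open>\<open>SConj\<close> is the strong conjunction written with an ampersand, \<open>Conj\<close> the weak
  conjunction.\<close>

datatype ('f, 'p) fm =
    Bot
  | Pred 'p "'f tm list"
  | SConj "('f, 'p) fm" "('f, 'p) fm"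
  | Imp "('f, 'p) fm" "('f, 'p) fm"
  | Conj "('f, 'p) fm" "('f, 'p) fm"
  | All nat "('f, 'p) fm"
  | Ex nat "('f, 'p) fm"

fun wf_tm :: "('f, 'p) lang \<Rightarrow> 'f tm \<Rightarrow> bool" where
  "wf_tm L (Var x) = True"
| "wf_tm L (Fun f ts) = (f \<in> fsyms L \<and> length ts = farity L f \<and> (\<forall>t\<in>set ts. wf_tm L t))"

fun wf_fm :: "('f, 'p) lang \<Rightarrow> ('f, 'p) fm \<Rightarrow> bool" where
  "wf_fm L Bot = True"
| "wf_fm L (Pred R ts) = (R \<in> psyms L \<and> length ts = parity L R \<and> (\<forall>t\<in>set ts. wf_tm L t))"
| "wf_fm L (SConj \<phi> \<psi>) = (wf_fm L \<phi> \<and> wf_fm L \<psi>)"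
| "wf_fm L (Imp \<phi> \<psi>) = (wf_fm L \<phi> \<and> wf_fm L \<psi>)"
| "wf_fm L (Conj \<phi> \<psi>) = (wf_fm L \<phi> \<and> wf_fm L \<psi>)"
| "wf_fm L (All x \<psi>) = wf_fm L \<psi>"
| "wf_fm L (Ex x \<psi>) = wf_fm L \<psi>"

fun fv_tm :: "'f tm \<Rightarrow> nat set" where
  "fv_tm (Var x) = {x}"
| "fv_tm (Fun f ts) = (\<Union>t\<in>set ts. fv_tm t)"

fun fv_fm :: "('f, 'p) fm \<Rightarrow> nat set" where
  "fv_fm Bot = {}"
| "fv_fm (Pred R ts) = (\<Union>t\<in>set ts. fv_tm t)"
| "fv_fm (SConj \<phi> \<psi>) = fv_fm \<phi> \<union> fv_fm \<psi>"
| "fv_fm (Imp \<phi> \<psi>) = fv_fm \<phi> \<union> fv_fm \<psi>"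
| "fv_fm (Conj \<phi> \<psi>) = fv_fm \<phi> \<union> fv_fm \<psi>"
| "fv_fm (All x \<psi>) = fv_fm \<psi> - {x}"
| "fv_fm (Ex x \<psi>) = fv_fm \<psi> - {x}"

definition is_sentence :: "('f, 'p) lang \<Rightarrow> ('f, 'p) fm \<Rightarrow> bool" where
  "is_sentence L \<phi> \<longleftrightarrow> wf_fm L \<phi> \<and> fv_fm \<phi> = {}"

definition is_theory :: "('f, 'p) lang \<Rightarrow> ('f, 'p) fm set \<Rightarrow> bool" where
  "is_theory L T \<longleftrightarrow> (\<forall>\<phi>\<in>T. is_sentence L \<phi>)"

record ('f, 'p, 'u) struct =
  univ :: "'u set"
  fint :: "'f \<Rightarrow> 'u list \<Rightarrow> 'u"
  pint :: "'p \<Rightarrow> 'u list \<Rightarrow> real"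

definition is_structure :: "('f, 'p) lang \<Rightarrow> real set \<Rightarrow> ('f, 'p, 'u) struct \<Rightarrow> bool" where
  "is_structure L V M \<longleftrightarrow>
     univ M \<noteq> {} \<and>
     (\<forall>f\<in>fsyms L. \<forall>as. length as = farity L f \<and> set as \<subseteq> univ M \<longrightarrow> fint M f as \<in> univ M) \<and>
     (\<forall>R\<in>psyms L. \<forall>as. length as = parity L R \<and> set as \<subseteq> univ M \<longrightarrow> pint M R as \<in> V)"

fun tm_val :: "('f, 'p, 'u) struct \<Rightarrow> (nat \<Rightarrow> 'u) \<Rightarrow> 'f tm \<Rightarrow> 'u" where
  "tm_val M e (Var x) = e x"
| "tm_val M e (Fun f ts) = fint M f (map (tm_val M e) ts)"

fun fm_val :: "('f, 'p, 'u) struct \<Rightarrow> (nat \<Rightarrow> 'u) \<Rightarrow> ('f, 'p) fm \<Rightarrow> real" where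
  "fm_val M e Bot = 1"
| "fm_val M e (Pred R ts) = pint M R (map (tm_val M e) ts)"
| "fm_val M e (SConj \<phi> \<psi>) = max (fm_val M e \<phi>) (fm_val M e \<psi>)"
| "fm_val M e (Imp \<phi> \<psi>) = (if fm_val M e \<phi> \<ge> fm_val M e \<psi> then 0 else fm_val M e \<psi>)"
| "fm_val M e (Conj \<phi> \<psi>) = max (fm_val M e \<phi>) (fm_val M e \<psi>)"
| "fm_val M e (All x \<psi>) = (SUP b\<in>univ M. fm_val M (e(x := b)) \<psi>)"
| "fm_val M e (Ex x \<psi>) = (INF b\<in>univ M. fm_val M (e(x := b)) \<psi>)"

text \<open>The value of a sentence does not depend on the assignment \<open>e\<close>; 0 is absolute truth.\<close>

definition satisfies :: "('f, 'p, 'u) struct \<Rightarrow> ('f, 'p) fm \<Rightarrow> bool" where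
  "satisfies M \<phi> \<longleftrightarrow> (\<forall>e. range e \<subseteq> univ M \<longrightarrow> fm_val M e \<phi> = 0)"

text \<open>HOL cannot quantify over types inside a formula, so the type from which the elements of
  the universes are drawn is a parameter; the universe itself is any nonempty subset of it.
  In the absence of equality, the downward Loewenheim-Skolem argument shows that, for \<open>V\<close>
  a Goedel set, satisfiability over any type at all implies satisfiability over the type
  \<open>('f, 'p) fm\<close>, so that the latter amounts to satisfiability by some structure.\<close>

definition satisfiable ::
    "'u itself \<Rightarrow> ('f, 'p) lang \<Rightarrow> real set \<Rightarrow> ('f, 'p) fm set \<Rightarrow> bool" where
  "satisfiable (_ :: 'u itself) L V T \<longleftrightarrow>
     (\<exists>M :: ('f, 'p, 'u) struct. is_structure L V M \<and> (\<forall>\<phi>\<in>T. satisfies M \<phi>))"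

definition finitely_satisfiable ::
    "'u itself \<Rightarrow> ('f, 'p) lang \<Rightarrow> real set \<Rightarrow> ('f, 'p) fm set \<Rightarrow> bool" where
  "finitely_satisfiable (U :: 'u itself) L V T \<longleftrightarrow>
     (\<forall>S. S \<subseteq> T \<and> finite S \<longrightarrow> satisfiable U L V S)"

end

theory Submission
  imports Defs "HOL-Analysis.Function_Topology"
begin

text \<open>Compactness makes every \<open>{x \<in> V. \<epsilon> \<le> x}\<close> with \<open>\<epsilon> > 0\<close> finite, so \<open>V\<close> is compact in the Euclidean
  topology, all its nonzero points are isolated, and the truth function of implication is continuous
  on \<open>V \<times> V\<close> (it fails to be so on \<open>[0,1]\<close>). Only the quantifiers obstruct continuity of truth values
  in the predicates. Skolem functions remove this obstacle: a bound need not be attained, so for each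
  \<open>n\<close> there is one function giving a witness up to \<open>1/(n+1)\<close>. Every model, restricted to the
  values of Skolem terms, yields a valuation of formulas over one fixed term universe, and the valuations
  arising in this way are described by equations and weak inequalities between coordinates, i.e. by a
  closed, hence compact, subset of a power of \<open>V\<close>. Truth of a sentence is a closed condition on it, so
  the finite intersection property provides a valuation that makes the whole theory true.\<close>

subsection \<open>Topology of the set of truth values\<close>

text \<open>For \<open>x > 0\<close> every other point has \<open>dmax\<close>-distance at least
  \<open>x\<close> from \<open>x\<close>, so the ball of radius \<open>x\<close> around
  \<open>x\<close> is a singleton. These singletons and one ball around \<open>0\<close> cover
  \<open>V\<close>, and a finite subcover leaves only finitely many points outside the ball around
  \<open>0\<close>.\<close>

lemma finite_dmax_compact_tail:
  assumes "godel_set V" "compact_space (dmax_topology V)" "0 < \<epsilon>"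
  shows "finite {x \<in> V. \<epsilon> \<le> x}"
proof -
  interpret Metric_space V dmax
    by (rule Metric_space_dmax)
  have V: "V \<subseteq> {0..1}" "0 \<in> V"
    using assms(1) by (auto simp: godel_set_def)
  let ?\<U> = "insert (mball 0 \<epsilon>) ((\<lambda>x. mball x x) ` {x \<in> V. \<epsilon> \<le> x})"
  have single: "mball x x \<subseteq> {x}" for x
    by (auto simp: dmax_def split: if_splits)
  have "x \<in> \<Union>?\<U>" if "x \<in> V" for x
  proof (cases "x < \<epsilon>")
    case True
    with that V have "x \<in> mball 0 \<epsilon>"
      by (auto simp: dmax_def assms(3))
    then show ?thesis by blast
  next
    case False
    with that assms(3) have "x \<in> mball x x" "x \<in> {x \<in> V. \<epsilon> \<le> x}"
      by (auto simp: dmax_def)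
    then show ?thesis by blast
  qed
  then have "topspace mtopology \<subseteq> \<Union>?\<U>"
    unfolding topspace_mtopology by (rule subsetI)
  moreover have "\<forall>U\<in>?\<U>. openin mtopology U"
    by auto
  ultimately obtain \<F> where \<F>: "finite \<F>" "\<F> \<subseteq> ?\<U>" "topspace mtopology \<subseteq> \<Union>\<F>"
    using assms(2) unfolding compact_space_alt by meson
  have "finite U" if "U \<in> \<F> - {mball 0 \<epsilon>}" for U
    using that \<F>(2) finite_subset[OF single] by blast
  with \<F>(1) have "finite (\<Union>(\<F> - {mball 0 \<epsilon>}))"
    by auto
  moreover have "{x \<in> V. \<epsilon> \<le> x} \<subseteq> \<Union>(\<F> - {mball 0 \<epsilon>})"
  proof
    fix x assume x: "x \<in> {x \<in> V. \<epsilon> \<le> x}"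
    then obtain U where "U \<in> \<F>" "x \<in> U"
      using \<F>(3) by auto
    moreover have "x \<notin> mball 0 \<epsilon>"
      using x assms(3) by (simp add: dmax_def)
    ultimately show "x \<in> \<Union>(\<F> - {mball 0 \<epsilon>})"
      by blast
  qed
  ultimately show ?thesis
    by (rule finite_subset[rotated])
qed

text \<open>The member of a cover that contains \<open>0\<close> contains all points of
  \<open>V\<close> below some \<epsilon>, and the finitely many remaining points need finitely many
  further members.\<close>

lemma compact_if_finite_tails:
  fixes V :: "real set"
  assumes "V \<subseteq> {0..1}" "0 \<in> V" and fin: "\<And>\<epsilon>. 0 < \<epsilon> \<Longrightarrow> finite {x \<in> V. \<epsilon> \<le> x}"
  shows "compact V"
proof (rule compactI)
  fix \<C> assume \<C>: "\<forall>C\<in>\<C>. open C" "V \<subseteq> \<Union>\<C>"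
  then obtain C where C: "C \<in> \<C>" "0 \<in> C" "open C"
    using assms(2) by blast
  then obtain \<epsilon> where \<epsilon>: "0 < \<epsilon>" "ball 0 \<epsilon> \<subseteq> C"
    by (elim openE)
  have "compact {x \<in> V. \<epsilon> \<le> x}"
    using fin[OF \<epsilon>(1)] by (rule finite_imp_compact)
  moreover have "{x \<in> V. \<epsilon> \<le> x} \<subseteq> \<Union>\<C>"
    using \<C>(2) by blast
  ultimately obtain \<D> where \<D>: "\<D> \<subseteq> \<C>" "finite \<D>" "{x \<in> V. \<epsilon> \<le> x} \<subseteq> \<Union>\<D>"
    using \<C>(1) by (elim compactE) auto
  have "V \<subseteq> \<Union>(insert C \<D>)"
  proof
    fix x assume x: "x \<in> V"
    show "x \<in> \<Union>(insert C \<D>)"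
    proof (cases "\<epsilon> \<le> x")
      case True
      with x \<D>(3) show ?thesis by blast
    next
      case False
      moreover have "0 \<le> x"
        using x assms(1) by auto
      ultimately have "x \<in> ball 0 \<epsilon>"
        by simp
      with \<epsilon>(2) show ?thesis by blast
    qed
  qed
  moreover have "insert C \<D> \<subseteq> \<C>" "finite (insert C \<D>)"
    using C(1) \<D> by simp_all
  ultimately show "\<exists>\<D>\<subseteq>\<C>. finite \<D> \<and> V \<subseteq> \<Union>\<D>"
    by (intro exI[of _ "insert C \<D>"] conjI)
qed

lemma eventually_isolated:
  fixes t :: real
  assumes fin: "\<And>\<epsilon>. 0 < \<epsilon> \<Longrightarrow> finite {x \<in> V. \<epsilon> \<le> x}" and "0 < t"
  shows "\<forall>\<^sub>F x in nhds t. x \<in> V \<longrightarrow> x = t"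
proof -
  let ?S = "{t / 2<..} - ({x \<in> V. t / 2 \<le> x} - {t})"
  have "open ?S"
    using fin[of "t / 2"] \<open>0 < t\<close> by (intro open_Diff open_greaterThan finite_imp_closed) auto
  moreover have "t \<in> ?S" "\<forall>x\<in>?S. x \<in> V \<longrightarrow> x = t"
    using \<open>0 < t\<close> by auto
  ultimately show ?thesis
    unfolding eventually_nhds by blast
qed

definition imp_val :: "real \<Rightarrow> real \<Rightarrow> real" where
  "imp_val a b = (if b \<le> a then 0 else b)"

text \<open>Positive points of \<open>V\<close> are isolated, so a positive coordinate is eventually
  constant. This removes the jump of the implication on the diagonal away from \<open>0\<close>; at
  \<open>b = 0\<close> the value is squeezed between \<open>0\<close> and the second
  coordinate.\<close>

lemma imp_val_continuous_on:
  fixes V :: "real set"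
  assumes "V \<subseteq> {0..1}" and fin: "\<And>\<epsilon>. 0 < \<epsilon> \<Longrightarrow> finite {x \<in> V. \<epsilon> \<le> x}"
  shows "continuous_on (V \<times> V) (\<lambda>(a, b). imp_val a b)"
  unfolding continuous_on_def
proof (clarify)
  fix a b assume ab: "a \<in> V" "b \<in> V"
  let ?F = "at (a, b) within V \<times> V"
  have isolated: "\<forall>\<^sub>F x in nhds t. x \<in> V \<longrightarrow> x = t" if "0 < t" for t
    using fin that by (rule eventually_isolated)
  have V: "\<forall>\<^sub>F p in ?F. fst p \<in> V \<and> snd p \<in> V"
    unfolding eventually_at_filter by (rule always_eventually) auto
  have fst: "filterlim fst (nhds a) ?F" and snd: "filterlim snd (nhds b) ?F"
    by (auto intro!: tendsto_eq_intros)
  show "((\<lambda>(a, b). imp_val a b) \<longlongrightarrow> imp_val a b) ?F"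
  proof (cases "b = 0")
    case True
    have "((\<lambda>p. imp_val (fst p) (snd p)) \<longlongrightarrow> 0) ?F"
    proof (rule tendsto_sandwich)
      show "((\<lambda>_. 0) \<longlongrightarrow> 0) ?F" "(snd \<longlongrightarrow> 0) ?F"
        using snd True by auto
      show "\<forall>\<^sub>F p in ?F. 0 \<le> imp_val (fst p) (snd p)" "\<forall>\<^sub>F p in ?F. imp_val (fst p) (snd p) \<le> snd p"
        using V assms(1) by (auto elim!: eventually_mono simp: imp_val_def)
    qed
    moreover have "imp_val a b = 0"
      using ab assms(1) True by (auto simp: imp_val_def)
    ultimately show ?thesis
      by (simp add: case_prod_unfold)
  next
    case False
    then have "0 < b" using ab assms(1) by force
    have ev_b: "\<forall>\<^sub>F p in ?F. snd p = b"
      using eventually_compose_filterlim[OF isolated[OF \<open>0 < b\<close>] snd] V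
      by (rule eventually_elim2) auto
    have "\<forall>\<^sub>F p in ?F. imp_val (fst p) b = imp_val a b"
    proof (cases "a = 0")
      \<comment> \<open>The point \<open>0\<close> may be an accumulation point of \<open>V\<close>,
        but the value is \<open>b\<close> as soon as the first coordinate is below
        \<open>b\<close>.\<close>
      case True
      with fst \<open>0 < b\<close> have "\<forall>\<^sub>F p in ?F. fst p < b"
        by (auto dest: order_tendstoD)
      then show ?thesis
        by eventually_elim (use True \<open>0 < b\<close> in \<open>auto simp: imp_val_def\<close>)
    next
      case False
      then have "0 < a" using ab assms(1) by force
      from eventually_compose_filterlim[OF isolated[OF this] fst] V
      show ?thesis
        by (rule eventually_elim2) auto
    qed
    with ev_b have "\<forall>\<^sub>F p in ?F. (case p of (x, y) \<Rightarrow> imp_val x y) = imp_val a b"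
      by eventually_elim (auto simp: case_prod_beta)
    then show ?thesis
      by (simp add: tendsto_eventually)
  qed
qed

section \<open>Compact and closed sets of functions\<close>

lemma compact_functions_into:
  fixes V :: "'b::topological_space set"
  assumes "compact V"
  shows "compact {F :: 'i \<Rightarrow> 'b. \<forall>i. F i \<in> V}"
proof -
  \<comment> \<open>This is Tychonoff's theorem for a constant family.\<close>
  have "compactin (product_topology (\<lambda>_::'i. euclidean) UNIV) (UNIV \<rightarrow>\<^sub>E V)"
    using assms by (simp add: compactin_PiE)
  moreover have "(UNIV \<rightarrow>\<^sub>E V) = {F :: 'i \<Rightarrow> 'b. \<forall>i. F i \<in> V}"
    by auto
  ultimately show ?thesis
    by (simp add: euclidean_product_topology)
qed

lemma le_if_le_plus_inverse_Suc:
  fixes a b :: real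
  assumes "\<And>n. a \<le> b + 1 / Suc n"
  shows "a \<le> b"
proof (rule field_le_epsilon)
  fix \<epsilon> :: real assume "0 < \<epsilon>"
  then obtain n where "1 / Suc n < \<epsilon>"
    by (rule nat_approx_posE)
  with assms[of n] show "a \<le> b + \<epsilon>"
    by linarith
qed

lemma closed_functions_into:
  fixes V :: "'b::topological_space set"
  assumes "closed V"
  shows "closed {F :: 'i \<Rightarrow> 'b. \<forall>i. F i \<in> V}"
proof (rule closed_Collect_all)
  fix i
  show "closed {F :: 'i \<Rightarrow> 'b. F i \<in> V}"
    using closed_vimage[OF assms continuous_on_product_coordinates[of i]]
    by (simp add: vimage_def)
qed

text \<open>Continuity on \<open>K\<close> is enough when the set is cut down to \<open>K\<close>.
  This matters because the implication is continuous only for values in \<open>V\<close>.\<close>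

lemma closed_Collect_eq_on:
  fixes f g :: "'a::topological_space \<Rightarrow> real"
  assumes "closed K" "continuous_on K f" "continuous_on K g"
  shows "closed {x \<in> K. f x = g x}"
proof -
  have "{x \<in> K. f x = g x} = {x \<in> K. f x \<le> g x} \<inter> {x \<in> K. g x \<le> f x}"
    by auto
  then show ?thesis
    using assms by (auto intro!: closed_Int continuous_on_closed_Collect_le)
qed

lemma closed_Collect_conj_on:
  assumes "closed {x \<in> K. P x}" "closed {x \<in> K. Q x}"
  shows "closed {x \<in> K. P x \<and> Q x}"
proof -
  have "{x \<in> K. P x \<and> Q x} = {x \<in> K. P x} \<inter> {x \<in> K. Q x}"
    by auto
  then show ?thesis
    using assms by auto
qed

lemma closed_Collect_all_on:
  assumes "\<And>i. closed {x \<in> K. P i x}"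
  shows "closed {x \<in> K. \<forall>i. P i x}"
proof -
  have "{x \<in> K. \<forall>i. P i x} = (\<Inter>i. {x \<in> K. P i x})"
    by auto
  then show ?thesis
    using assms by auto
qed

subsection \<open>Structures with total interpretations\<close>

text \<open>No language and no arity occur here: arbitrary codes are going to be evaluated in the
  structure, including those that apply symbols outside the language or to lists of the wrong
  length.\<close>

definition total_structure :: "real set \<Rightarrow> ('f, 'p, 'u) struct \<Rightarrow> bool" where
  "total_structure V M \<longleftrightarrow>
     univ M \<noteq> {} \<and>
     (\<forall>f as. set as \<subseteq> univ M \<longrightarrow> fint M f as \<in> univ M) \<and>
     (\<forall>R as. set as \<subseteq> univ M \<longrightarrow> pint M R as \<in> V)"

definition totalize :: "real set \<Rightarrow> 'u \<Rightarrow> ('f, 'p, 'u) struct \<Rightarrow> ('f, 'p, 'u) struct" where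
  "totalize V c M =
     \<lparr>univ = univ M,
      fint = (\<lambda>f as. if fint M f as \<in> univ M then fint M f as else c),
      pint = (\<lambda>R as. if pint M R as \<in> V then pint M R as else 0)\<rparr>"

lemma totalize_sel:
  "univ (totalize V c M) = univ M"
  "fint (totalize V c M) f as = (if fint M f as \<in> univ M then fint M f as else c)"
  "pint (totalize V c M) R as = (if pint M R as \<in> V then pint M R as else 0)"
  by (simp_all add: totalize_def)

lemma total_structure_totalize:
  "is_structure L V M \<Longrightarrow> c \<in> univ M \<Longrightarrow> 0 \<in> V \<Longrightarrow> total_structure V (totalize V c M)"
  by (auto simp: total_structure_def totalize_sel)

lemma tm_val_in_univ:
  assumes "is_structure L V M" "range e \<subseteq> univ M" "wf_tm L t"
  shows "tm_val M e t \<in> univ M"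
  using assms(3)
proof (induction t)
  case (Var x)
  then show ?case using assms(2) by auto
next
  case (Fun f ts)
  then have "length (map (tm_val M e) ts) = farity L f" "set (map (tm_val M e) ts) \<subseteq> univ M"
    by auto
  then show ?case
    using assms(1) Fun.prems unfolding is_structure_def by (simp del: set_map length_map)
qed

lemma tm_val_totalize:
  assumes "is_structure L V M" "range e \<subseteq> univ M" "wf_tm L t"
  shows "tm_val (totalize V c M) e t = tm_val M e t"
  using assms(3)
proof (induction t)
  case (Fun f ts)
  then have "map (tm_val (totalize V c M) e) ts = map (tm_val M e) ts"
    by auto
  then show ?case
    using tm_val_in_univ[OF assms(1,2) Fun.prems] by (simp only: tm_val.simps totalize_sel if_True)
qed simp

text \<open>Evaluating a well-formed formula only meets values that already lie in the universe or
  in \<open>V\<close>, so the defaults \<open>c\<close> and \<open>0\<close> never enter.\<close>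

lemma fm_val_totalize:
  assumes "is_structure L V M" "range e \<subseteq> univ M" "wf_fm L \<phi>"
  shows "fm_val (totalize V c M) e \<phi> = fm_val M e \<phi>"
  using assms(2,3)
proof (induction \<phi> arbitrary: e)
  case (Pred R ts)
  then have "length (map (tm_val M e) ts) = parity L R" "set (map (tm_val M e) ts) \<subseteq> univ M"
    using tm_val_in_univ[OF assms(1)] by auto
  then have "pint M R (map (tm_val M e) ts) \<in> V"
    using assms(1) Pred.prems unfolding is_structure_def by (simp del: set_map length_map)
  moreover have "map (tm_val (totalize V c M) e) ts = map (tm_val M e) ts"
    using tm_val_totalize[OF assms(1)] Pred.prems by auto
  ultimately show ?case
    by (simp only: fm_val.simps totalize_sel if_True)
next
  case (All x \<psi>)
  have "fm_val (totalize V c M) (e(x := b)) \<psi> = fm_val M (e(x := b)) \<psi>" if "b \<in> univ M" for b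
    using that All.prems by (intro All.IH) auto
  then show ?case by (simp add: totalize_sel)
next
  case (Ex x \<psi>)
  have "fm_val (totalize V c M) (e(x := b)) \<psi> = fm_val M (e(x := b)) \<psi>" if "b \<in> univ M" for b
    using that Ex.prems by (intro Ex.IH) auto
  then show ?case by (simp add: totalize_sel)
qed auto

lemma tm_val_cong: "(\<And>k. k \<in> fv_tm t \<Longrightarrow> e k = d k) \<Longrightarrow> tm_val M e t = tm_val M d t"
proof (induction t)
  case (Fun f ts)
  then have "map (tm_val M e) ts = map (tm_val M d) ts"
    by auto
  then show ?case by (simp only: tm_val.simps)
qed simp

lemma fm_val_cong: "(\<And>k. k \<in> fv_fm \<phi> \<Longrightarrow> e k = d k) \<Longrightarrow> fm_val M e \<phi> = fm_val M d \<phi>"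
proof (induction \<phi> arbitrary: e d)
  case (Pred R ts)
  then have "map (tm_val M e) ts = map (tm_val M d) ts"
    by (auto intro!: tm_val_cong)
  then show ?case by (simp only: fm_val.simps)
next
  case (SConj \<phi> \<psi>)
  have "fm_val M e \<phi> = fm_val M d \<phi>"
    by (rule SConj.IH(1)) (simp add: SConj.prems)
  moreover have "fm_val M e \<psi> = fm_val M d \<psi>"
    by (rule SConj.IH(2)) (simp add: SConj.prems)
  ultimately show ?case by simp
next
  case (Imp \<phi> \<psi>)
  have "fm_val M e \<phi> = fm_val M d \<phi>"
    by (rule Imp.IH(1)) (simp add: Imp.prems)
  moreover have "fm_val M e \<psi> = fm_val M d \<psi>"
    by (rule Imp.IH(2)) (simp add: Imp.prems)
  ultimately show ?case by simp
next
  case (Conj \<phi> \<psi>)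
  have "fm_val M e \<phi> = fm_val M d \<phi>"
    by (rule Conj.IH(1)) (simp add: Conj.prems)
  moreover have "fm_val M e \<psi> = fm_val M d \<psi>"
    by (rule Conj.IH(2)) (simp add: Conj.prems)
  ultimately show ?case by simp
next
  case (All x \<psi>)
  then have "fm_val M (e(x := b)) \<psi> = fm_val M (d(x := b)) \<psi>" for b
    by (intro All.IH) auto
  then show ?case by simp
next
  case (Ex x \<psi>)
  then have "fm_val M (e(x := b)) \<psi> = fm_val M (d(x := b)) \<psi>" for b
    by (intro Ex.IH) auto
  then show ?case by simp
qed simp

section \<open>Truth values and approximate witnesses in total structures\<close>

lemma finite_fv_tm: "finite (fv_tm t)"
  by (induction t) auto

lemma finite_fv_fm: "finite (fv_fm \<phi>)"
  by (induction \<phi>) (auto simp: finite_fv_tm)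

lemma tm_val_total:
  "total_structure V M \<Longrightarrow> range e \<subseteq> univ M \<Longrightarrow> tm_val M e t \<in> univ M"
  by (induction t) (auto simp: total_structure_def image_subset_iff)

text \<open>Closedness of \<open>V\<close> serves the quantifiers: a supremum or infimum of a
  nonempty bounded subset of \<open>V\<close> stays in \<open>V\<close>.\<close>

lemma fm_val_in_truth_values:
  assumes M: "total_structure V M" and V: "godel_set V" "closed V" and "range e \<subseteq> univ M"
  shows "fm_val M e \<phi> \<in> V"
  using assms(4)
proof (induction \<phi> arbitrary: e)
  case Bot
  then show ?case using V by (simp add: godel_set_def)
next
  case (Pred R ts)
  have "set (map (tm_val M e) ts) \<subseteq> univ M"
    using tm_val_total[OF M Pred.prems] by auto
  then show ?case
    using M by (simp add: total_structure_def del: set_map)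
next
  case (SConj \<phi> \<psi>)
  then show ?case by (simp add: max_def)
next
  case (Imp \<phi> \<psi>)
  then show ?case using V by (simp add: godel_set_def)
next
  case (Conj \<phi> \<psi>)
  then show ?case by (simp add: max_def)
next
  case (All x \<psi>)
  let ?A = "(\<lambda>b. fm_val M (e(x := b)) \<psi>) ` univ M"
  have A: "?A \<subseteq> V"
    using All.prems by (auto intro!: All.IH)
  have "bdd_above ?A"
    by (rule bdd_above_mono[OF _ A]) (use V in \<open>auto simp: godel_set_def intro: bdd_above_mono\<close>)
  with A show ?case
    using M V(2) by (simp add: total_structure_def closed_subset_contains_Sup)
next
  case (Ex x \<psi>)
  let ?A = "(\<lambda>b. fm_val M (e(x := b)) \<psi>) ` univ M"
  have A: "?A \<subseteq> V"
    using Ex.prems by (auto intro!: Ex.IH)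
  have "bdd_below ?A"
    by (rule bdd_below_mono[OF _ A]) (use V in \<open>auto simp: godel_set_def intro: bdd_below_mono\<close>)
  with A show ?case
    using M V(2) by (simp add: total_structure_def closed_subset_contains_Inf)
qed

lemma fm_val_bounds:
  assumes "total_structure V M" "godel_set V" "closed V" "range e \<subseteq> univ M"
  shows "0 \<le> fm_val M e \<phi>" "fm_val M e \<phi> \<le> 1"
  using fm_val_in_truth_values[OF assms, of \<phi>] assms(2) by (auto simp: godel_set_def)

lemma bdd_fm_val:
  assumes "total_structure V M" "godel_set V" "closed V" "range e \<subseteq> univ M"
  shows "bdd_above ((\<lambda>b. fm_val M (e(x := b)) \<psi>) ` univ M)"
    and "bdd_below ((\<lambda>b. fm_val M (e(x := b)) \<psi>) ` univ M)"
proof -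
  have "range (e(x := b)) \<subseteq> univ M" if "b \<in> univ M" for b
    using assms(4) that by auto
  note bounds = fm_val_bounds[OF assms(1-3) this]
  show "bdd_above ((\<lambda>b. fm_val M (e(x := b)) \<psi>) ` univ M)"
    using bounds(2) by (rule bdd_aboveI2)
  show "bdd_below ((\<lambda>b. fm_val M (e(x := b)) \<psi>) ` univ M)"
    using bounds(1) by (rule bdd_belowI2)
qed

text \<open>The absolute value treats both quantifiers at once. For a formula that does not start
  with a quantifier any element qualifies, so that witnesses exist without a case
  distinction.\<close>

definition approx_witness :: "('f, 'p, 'u) struct \<Rightarrow> nat \<Rightarrow> ('f, 'p) fm \<Rightarrow> (nat \<Rightarrow> 'u) \<Rightarrow> 'u \<Rightarrow> bool" where
  "approx_witness M n \<phi> e b \<longleftrightarrow>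
     b \<in> univ M \<and>
     (\<forall>x \<psi>. \<phi> = All x \<psi> \<or> \<phi> = Ex x \<psi> \<longrightarrow>
        \<bar>fm_val M (e(x := b)) \<psi> - fm_val M e \<phi>\<bar> \<le> 1 / Suc n)"

text \<open>Thanks to this a witness function needs only the finitely many values of the free
  variables as arguments.\<close>

lemma approx_witness_cong:
  assumes "\<And>k. k \<in> fv_fm \<phi> \<Longrightarrow> e k = d k"
  shows "approx_witness M n \<phi> e b = approx_witness M n \<phi> d b"
proof -
  have "fm_val M (e(x := b)) \<psi> = fm_val M (d(x := b)) \<psi>" if "\<phi> = All x \<psi> \<or> \<phi> = Ex x \<psi>" for x \<psi>
    using that assms by (intro fm_val_cong) auto
  with fm_val_cong[of \<phi> e d M, OF assms] show ?thesis
    by (auto simp: approx_witness_def)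
qed

lemma approx_witness_exists:
  assumes M: "total_structure V M" and V: "godel_set V" "closed V" and e: "range e \<subseteq> univ M"
  shows "\<exists>b. approx_witness M n \<phi> e b"
proof -
  have ne: "univ M \<noteq> {}"
    using M by (simp add: total_structure_def)
  note bdd = bdd_fm_val[OF M V e]
  show ?thesis
  proof (cases "\<exists>x \<psi>. \<phi> = All x \<psi> \<or> \<phi> = Ex x \<psi>")
    case False
    then show ?thesis
      using ne by (auto simp: approx_witness_def)
  next
    case True
    then obtain x \<psi> where "\<phi> = All x \<psi> \<or> \<phi> = Ex x \<psi>"
      by auto
    then show ?thesis
    proof
      assume \<phi>: "\<phi> = All x \<psi>"
      have "fm_val M e \<phi> - 1 / Suc n < (SUP b\<in>univ M. fm_val M (e(x := b)) \<psi>)"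
        by (simp add: \<phi>)
      then obtain b where "b \<in> univ M" "fm_val M e \<phi> - 1 / Suc n < fm_val M (e(x := b)) \<psi>"
        using less_cSUP_iff[OF ne bdd(1)] by blast
      moreover have "fm_val M (e(x := b)) \<psi> \<le> fm_val M e \<phi>"
        using \<open>b \<in> univ M\<close> bdd(1) by (auto simp: \<phi> intro: cSUP_upper)
      ultimately have "approx_witness M n \<phi> e b"
        by (auto simp: approx_witness_def \<phi>)
      then show ?thesis ..
    next
      assume \<phi>: "\<phi> = Ex x \<psi>"
      have "(INF b\<in>univ M. fm_val M (e(x := b)) \<psi>) < fm_val M e \<phi> + 1 / Suc n"
        by (simp add: \<phi>)
      then obtain b where "b \<in> univ M" "fm_val M (e(x := b)) \<psi> < fm_val M e \<phi> + 1 / Suc n"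
        using cINF_less_iff[OF ne bdd(2)] by blast
      moreover have "fm_val M e \<phi> \<le> fm_val M (e(x := b)) \<psi>"
        using \<open>b \<in> univ M\<close> bdd(2) by (auto simp: \<phi> intro: cINF_lower)
      ultimately have "approx_witness M n \<phi> e b"
        by (auto simp: approx_witness_def \<phi>)
      then show ?thesis ..
    qed
  qed
qed

subsection \<open>Skolem terms\<close>

text \<open>Formulas serve as codes for Skolem terms: \<open>Imp\<close> codes the application of a function symbol,
  \<open>SConj\<close> the application of a witness function, and \<open>Conj\<close> the lists of arguments.\<close>

fun list_code :: "('f, 'p) fm list \<Rightarrow> ('f, 'p) fm" where
  "list_code [] = Bot"
| "list_code (a # as) = Conj a (list_code as)"

text \<open>Any injective map from function symbols to formulas would do; \<open>undefined\<close>
  is a placeholder, and \<open>f\<close> is recovered from the only argument.\<close>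

definition fsym_code :: "'f \<Rightarrow> ('f, 'p) fm" where
  "fsym_code f = Pred undefined [Fun f []]"

definition app_code :: "'f \<Rightarrow> ('f, 'p) fm list \<Rightarrow> ('f, 'p) fm" where
  "app_code f as = Imp (fsym_code f) (list_code as)"

definition fv_bound :: "('f, 'p) fm \<Rightarrow> nat" where
  "fv_bound \<phi> = (SOME m. \<forall>k\<in>fv_fm \<phi>. k < m)"

text \<open>The quantifier in \<open>All n \<phi>\<close> binds nothing here: it merely stores the
  precision index \<open>n\<close> together with the quantified formula \<phi> that is to be
  witnessed.\<close>

definition wit_code :: "nat \<Rightarrow> ('f, 'p) fm \<Rightarrow> (nat \<Rightarrow> ('f, 'p) fm) \<Rightarrow> ('f, 'p) fm" where
  "wit_code n \<phi> e = SConj (All n \<phi>) (list_code (map e [0..<fv_bound \<phi>]))"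

text \<open>This evaluates Skolem terms in \<open>M\<close>. The two functions read the same
  datatype once as an element and once as an argument list. The choice operator acts as the Skolem
  function; \<open>c\<close> is the value where no witness exists or the code has no
  meaning.\<close>

fun decode :: "('f, 'p, 'u) struct \<Rightarrow> 'u \<Rightarrow> ('f, 'p) fm \<Rightarrow> 'u"
  and decode_args :: "('f, 'p, 'u) struct \<Rightarrow> 'u \<Rightarrow> ('f, 'p) fm \<Rightarrow> 'u list" where
  "decode M c (Imp s a) = fint M (THE f. s = fsym_code f) (decode_args M c a)"
| "decode M c (SConj s a) =
     (let Q = (\<lambda>b. \<exists>n \<phi>. s = All n \<phi> \<and> approx_witness M n \<phi> (nth (decode_args M c a)) b)
      in if (\<exists>b. Q b) then Eps Q else c)"
| "decode M c _ = c"
| "decode_args M c (Conj a b) = decode M c a # decode_args M c b"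
| "decode_args M c _ = []"

lemma decode_args_list_code [simp]: "decode_args M c (list_code as) = map (decode M c) as"
  by (induction as) auto

lemma decode_app_code: "decode M c (app_code f as) = fint M f (map (decode M c) as)"
  by (simp add: app_code_def fsym_code_def)

lemma decode_in_univ:
  assumes M: "total_structure V M" and c: "c \<in> univ M"
  shows "decode M c a \<in> univ M" "set (decode_args M c a) \<subseteq> univ M"
proof (induction a)
  case (SConj s a)
  {
    case 1
    let ?Q = "\<lambda>b. \<exists>n \<phi>. s = All n \<phi> \<and> approx_witness M n \<phi> (nth (decode_args M c a)) b"
    have "Eps ?Q \<in> univ M" if "\<exists>b. ?Q b"
      using someI_ex[OF that] by (auto simp: approx_witness_def)
    then show ?case
      using c by (simp add: Let_def)
  next
    case 2
    then show ?case by simp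
  }
qed (use M c in \<open>auto simp: total_structure_def\<close>)

lemma fv_bound: "k \<in> fv_fm \<phi> \<Longrightarrow> k < fv_bound \<phi>"
proof -
  have "\<exists>m. \<forall>k\<in>fv_fm \<phi>. k < m"
    using finite_fv_fm by (simp add: finite_nat_set_iff_bounded)
  from someI_ex[OF this] show "k \<in> fv_fm \<phi> \<Longrightarrow> k < fv_bound \<phi>"
    by (simp add: fv_bound_def)
qed

text \<open>The stored argument list agrees with the decoded assignment on the free variables of
  \<phi>, so the choice made by \<open>decode\<close> is among the approximate witnesses for that
  assignment, and there is at least one.\<close>

lemma decode_wit_code:
  assumes M: "total_structure V M" and V: "godel_set V" "closed V" and c: "c \<in> univ M"
  shows "approx_witness M n \<phi> (decode M c \<circ> e) (decode M c (wit_code n \<phi> e))"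
proof -
  let ?d = "nth (map (decode M c) (map e [0..<fv_bound \<phi>]))"
  have eq: "approx_witness M n \<phi> ?d b = approx_witness M n \<phi> (decode M c \<circ> e) b" for b
    by (rule approx_witness_cong) (simp add: fv_bound)
  have "\<exists>b. approx_witness M n \<phi> (decode M c \<circ> e) b"
    using decode_in_univ(1)[OF M c] by (intro approx_witness_exists[OF M V]) auto
  then show ?thesis
    using someI_ex[of "\<lambda>b. approx_witness M n \<phi> (decode M c \<circ> e) b"]
    by (simp add: wit_code_def eq[simplified])
qed

section \<open>The term structure on codes\<close>

definition code_structure :: "('p \<Rightarrow> ('f, 'p) fm list \<Rightarrow> real) \<Rightarrow> ('f, 'p, ('f, 'p) fm) struct" where
  "code_structure P = \<lparr>univ = UNIV, fint = app_code, pint = P\<rparr>"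

lemma code_structure_sel [simp]:
  "univ (code_structure P) = UNIV" "fint (code_structure P) = app_code" "pint (code_structure P) = P"
  by (simp_all add: code_structure_def)

text \<open>Values of terms do not depend on the predicates, so the zero predicates are only a
  placeholder.\<close>

abbreviation tm_code :: "(nat \<Rightarrow> ('f, 'p) fm) \<Rightarrow> 'f tm \<Rightarrow> ('f, 'p) fm" where
  "tm_code \<equiv> tm_val (code_structure (\<lambda>_ _. 0))"

lemma tm_val_code_structure: "tm_val (code_structure P) e t = tm_code e t"
proof (induction t)
  case (Fun f ts)
  then have "map (tm_val (code_structure P) e) ts = map (tm_code e) ts"
    by simp
  then show ?case by (simp only: tm_val.simps code_structure_sel)
qed simp

text \<open>Decoding is a homomorphism for the function symbols, by
  \<open>decode_app_code\<close>.\<close>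

lemma tm_val_decode: "tm_val M (decode M c \<circ> e) t = decode M c (tm_code e t)"
proof (induction t)
  case (Fun f ts)
  have "map (tm_val M (decode M c \<circ> e)) ts = map (decode M c) (map (tm_code e) ts)"
    unfolding map_map by (rule map_cong[OF refl]) (simp only: Fun.IH comp_apply)
  then show ?case
    by (simp only: tm_val.simps code_structure_sel decode_app_code)
qed simp

subsection \<open>Henkin valuations\<close>

type_synonym ('f, 'p) valuation = "('f, 'p) fm \<times> (nat \<Rightarrow> ('f, 'p) fm) \<Rightarrow> real"

text \<open>For fixed parameters each condition is an equation or a weak inequality between finitely
  many coordinates of \<open>F\<close>. \<open>Pred_cong\<close> makes the value of an atom a
  function of the codes of its arguments; the two witness conditions express attained bounds up to
  \<open>1 / Suc n\<close>, which avoids a supremum over infinitely many coordinates.\<close>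

locale henkin =
  fixes F :: "('f, 'p) valuation"
  assumes Bot: "F (Bot, e) = 1"
    and Pred_cong: "map (tm_code e) ts = map (tm_code d) us \<Longrightarrow> F (Pred R ts, e) = F (Pred R us, d)"
    and SConj: "F (SConj \<phi> \<psi>, e) = max (F (\<phi>, e)) (F (\<psi>, e))"
    and Imp: "F (Imp \<phi> \<psi>, e) = imp_val (F (\<phi>, e)) (F (\<psi>, e))"
    and Conj: "F (Conj \<phi> \<psi>, e) = max (F (\<phi>, e)) (F (\<psi>, e))"
    and All_upper: "F (\<psi>, e(x := b)) \<le> F (All x \<psi>, e)"
    and All_witness: "F (All x \<psi>, e) \<le> F (\<psi>, e(x := wit_code n (All x \<psi>) e)) + 1 / Suc n"
    and Ex_lower: "F (Ex x \<psi>, e) \<le> F (\<psi>, e(x := b))"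
    and Ex_witness: "F (\<psi>, e(x := wit_code n (Ex x \<psi>) e)) \<le> F (Ex x \<psi>, e) + 1 / Suc n"

definition structure_valuation :: "('f, 'p, 'u) struct \<Rightarrow> 'u \<Rightarrow> ('f, 'p) valuation" where
  "structure_valuation M c = (\<lambda>(\<phi>, e). fm_val M (decode M c \<circ> e) \<phi>)"

lemma henkin_structure_valuation:
  assumes M: "total_structure V M" and V: "godel_set V" "closed V" and c: "c \<in> univ M"
  shows "henkin (structure_valuation M c)"
proof -
  let ?h = "decode M c"
  have in_univ: "range (?h \<circ> e) \<subseteq> univ M" for e
    using decode_in_univ(1)[OF M c] by auto
  note bdd = bdd_fm_val[OF M V in_univ]
  have witness: "\<bar>fm_val M ((?h \<circ> e)(x := ?h (wit_code n \<phi> e))) \<psi> - fm_val M (?h \<circ> e) \<phi>\<bar> \<le> 1 / Suc n"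
    if "\<phi> = All x \<psi> \<or> \<phi> = Ex x \<psi>" for \<phi> x \<psi> n e
    using decode_wit_code[OF M V c, of n \<phi> e] that by (auto simp: approx_witness_def)
  show ?thesis
  proof
    fix R ts us and e d :: "nat \<Rightarrow> ('a, 'b) fm"
    assume eq: "map (tm_code e) ts = map (tm_code d) us"
    have "map (tm_val M (?h \<circ> e)) ts = map ?h (map (tm_code e) ts)"
      by (simp add: tm_val_decode)
    also have "\<dots> = map ?h (map (tm_code d) us)"
      by (simp only: eq)
    also have "\<dots> = map (tm_val M (?h \<circ> d)) us"
      by (simp add: tm_val_decode)
    finally show "structure_valuation M c (Pred R ts, e) = structure_valuation M c (Pred R us, d)"
      by (simp only: structure_valuation_def prod.case fm_val.simps)
  next
    fix x \<psi> e b
    \<comment> \<open>Updating by a code and then decoding is updating by its decoded element, which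
      is one of the elements over which the quantifier in \<open>M\<close> ranges.\<close>
    have "?h b \<in> univ M"
      using decode_in_univ(1)[OF M c] .
    then show "structure_valuation M c (\<psi>, e(x := b)) \<le> structure_valuation M c (All x \<psi>, e)"
      and "structure_valuation M c (Ex x \<psi>, e) \<le> structure_valuation M c (\<psi>, e(x := b))"
      unfolding structure_valuation_def prod.case fun_upd_comp fm_val.simps
      by (rule cSUP_upper[OF _ bdd(1)], rule cINF_lower[OF bdd(2)])
  next
    fix x \<psi> e n
    show "structure_valuation M c (All x \<psi>, e)
        \<le> structure_valuation M c (\<psi>, e(x := wit_code n (All x \<psi>) e)) + 1 / Suc n"
      using witness[of "All x \<psi>" x \<psi> e n, OF disjI1[OF refl]]
      unfolding structure_valuation_def prod.case fun_upd_comp by linarith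
    show "structure_valuation M c (\<psi>, e(x := wit_code n (Ex x \<psi>) e))
        \<le> structure_valuation M c (Ex x \<psi>, e) + 1 / Suc n"
      using witness[of "Ex x \<psi>" x \<psi> e n, OF disjI2[OF refl]]
      unfolding structure_valuation_def prod.case fun_upd_comp by linarith
  qed (simp_all add: structure_valuation_def imp_val_def)
qed

text \<open>The value of \<open>R\<close> on a list of codes is read off from the atom with
  variables \<open>0, 1, ...\<close> under the assignment that lists these codes.\<close>

definition valuation_structure :: "('f, 'p) valuation \<Rightarrow> ('f, 'p, ('f, 'p) fm) struct" where
  "valuation_structure F = code_structure (\<lambda>R as. F (Pred R (map Var [0..<length as]), nth as))"

lemma univ_valuation_structure: "univ (valuation_structure F) = UNIV"
  by (simp add: valuation_structure_def)

text \<open>This is the truth lemma. For a quantifier, \<open>F\<close> gives a bound for all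
  instances, and the witnesses for all \<open>n\<close> together show that it is the supremum or
  infimum.\<close>

lemma (in henkin) fm_val_valuation_structure:
  "fm_val (valuation_structure F) e \<phi> = F (\<phi>, e)"
proof (induction \<phi> arbitrary: e)
  case (Pred R ts)
  let ?as = "map (tm_code e) ts"
  have "map (tm_code (nth ?as)) (map Var [0..<length ?as]) = ?as"
    by (rule nth_equalityI) simp_all
  then have "F (Pred R (map Var [0..<length ?as]), nth ?as) = F (Pred R ts, e)"
    by (rule Pred_cong)
  moreover have "map (tm_val (valuation_structure F) e) ts = ?as"
    unfolding valuation_structure_def by (rule map_cong[OF refl tm_val_code_structure])
  ultimately show ?case
    by (simp only: fm_val.simps) (simp add: valuation_structure_def)
next
  case (All x \<psi>)
  note upper = All_upper[of \<psi> e x]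
  have "F (All x \<psi>, e) \<le> (SUP b. F (\<psi>, e(x := b))) + 1 / Suc n" for n
  proof -
    have "F (All x \<psi>, e) \<le> F (\<psi>, e(x := wit_code n (All x \<psi>) e)) + 1 / Suc n"
      by (rule All_witness)
    also have "F (\<psi>, e(x := wit_code n (All x \<psi>) e)) \<le> (SUP b. F (\<psi>, e(x := b)))"
      using bdd_aboveI2[OF upper] by (rule cSUP_upper[OF UNIV_I])
    finally show ?thesis by simp
  qed
  then have "F (All x \<psi>, e) \<le> (SUP b. F (\<psi>, e(x := b)))"
    by (rule le_if_le_plus_inverse_Suc)
  moreover have "(SUP b. F (\<psi>, e(x := b))) \<le> F (All x \<psi>, e)"
    using upper by (rule cSUP_least[OF UNIV_not_empty])
  ultimately show ?case
    by (simp only: fm_val.simps All.IH univ_valuation_structure order.antisym)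
next
  case (Ex x \<psi>)
  note lower = Ex_lower[of x \<psi> e]
  have "(INF b. F (\<psi>, e(x := b))) \<le> F (Ex x \<psi>, e) + 1 / Suc n" for n
  proof -
    have "(INF b. F (\<psi>, e(x := b))) \<le> F (\<psi>, e(x := wit_code n (Ex x \<psi>) e))"
      using bdd_belowI2[OF lower] by (rule cINF_lower[OF _ UNIV_I])
    also have "\<dots> \<le> F (Ex x \<psi>, e) + 1 / Suc n"
      by (rule Ex_witness)
    finally show ?thesis .
  qed
  then have "(INF b. F (\<psi>, e(x := b))) \<le> F (Ex x \<psi>, e)"
    by (rule le_if_le_plus_inverse_Suc)
  moreover have "F (Ex x \<psi>, e) \<le> (INF b. F (\<psi>, e(x := b)))"
    using lower by (rule cINF_greatest[OF UNIV_not_empty])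
  ultimately show ?case
    by (simp only: fm_val.simps Ex.IH univ_valuation_structure order.antisym)
qed (simp_all add: Bot SConj Imp Conj imp_val_def)

section \<open>Closedness of the Henkin conditions and the compactness argument\<close>

lemma closed_henkin:
  assumes V: "godel_set V" "closed V" and fin: "\<And>\<epsilon>. 0 < \<epsilon> \<Longrightarrow> finite {x \<in> V. \<epsilon> \<le> x}"
  shows "closed {F :: ('f, 'p) valuation. (\<forall>i. F i \<in> V) \<and> henkin F}"
proof -
  define K where "K = {F :: ('f, 'p) valuation. \<forall>i. F i \<in> V}"
  have K: "closed K"
    unfolding K_def by (rule closed_functions_into[OF V(2)])
  have coord: "continuous_on K (\<lambda>F. F i)" for i
    by (rule continuous_on_subset[OF continuous_on_product_coordinates]) simp
  have imp: "continuous_on K (\<lambda>F. imp_val (F i) (F j))" for i j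
  proof -
    have "continuous_on (V \<times> V) (\<lambda>(a, b). imp_val a b)"
      using V(1) fin by (intro imp_val_continuous_on) (auto simp: godel_set_def)
    then have "continuous_on K (\<lambda>F. (\<lambda>(a, b). imp_val a b) (F i, F j))"
    proof (rule continuous_on_compose2)
      show "continuous_on K (\<lambda>F. (F i, F j))"
        by (intro continuous_on_Pair coord)
      show "(\<lambda>F. (F i, F j)) ` K \<subseteq> V \<times> V"
        unfolding K_def by blast
    qed
    then show ?thesis by simp
  qed
  \<comment> \<open>The premise of \<open>Pred_cong\<close> does not mention \<open>F\<close>, so
    the condition either is the bare equation or holds on all of \<open>K\<close>.\<close>
  have eq_if: "closed {F \<in> K. Q \<longrightarrow> f F = g F}"
    if "continuous_on K f" "continuous_on K g" for Q and f g :: "('f, 'p) valuation \<Rightarrow> real"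
    using closed_Collect_eq_on[OF K that] K by (cases Q) simp_all
  have "closed {F \<in> K. henkin F}"
    unfolding henkin_def
    by (intro closed_Collect_conj_on closed_Collect_all_on eq_if closed_Collect_eq_on[OF K]
        continuous_on_closed_Collect_le[OF _ _ K] coord imp continuous_on_max continuous_on_add continuous_on_const)
  then show ?thesis
    by (simp only: K_def mem_Collect_eq)
qed

theorem theorem7p10:
  fixes L :: "('f, 'p) lang" and V :: "real set" and T :: "('f, 'p) fm set"
  assumes "godel_set V"
    and "compact_space (dmax_topology V)"
    and "Hausdorff_space (dmax_topology V)"
    and "is_theory L T"
    and "finitely_satisfiable TYPE('u) L V T"
  shows "satisfiable TYPE(('f, 'p) fm) L V T"
proof -
  note fin = finite_dmax_compact_tail[OF assms(1,2)]
  have V: "V \<subseteq> {0..1}" "0 \<in> V"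
    using assms(1) by (auto simp: godel_set_def)
  have "compact V"
    using V fin by (rule compact_if_finite_tails)
  then have "closed V"
    by (rule compact_imp_closed)
  let ?K = "{F :: ('f, 'p) valuation. \<forall>i. F i \<in> V}"
  let ?H = "{F :: ('f, 'p) valuation. (\<forall>i. F i \<in> V) \<and> henkin F}"
  let ?Z = "\<lambda>\<sigma>. {F :: ('f, 'p) valuation. \<forall>e. F (\<sigma>, e) = 0}"
  \<comment> \<open>The candidates \<open>?H\<close> form a closed part of the compact power
    \<open>?K\<close> of \<open>V\<close>; the theory enters only through the closed sets
    \<open>?Z \<sigma>\<close>.\<close>
  have "compact (?K \<inter> ?H)"
    using compact_functions_into[OF \<open>compact V\<close>] closed_henkin[OF assms(1) \<open>closed V\<close> fin]
    by (rule compact_Int_closed)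
  also have "?K \<inter> ?H = ?H"
    by auto
  finally have "compact ?H" .
  then have "?H \<inter> (\<Inter>\<sigma>\<in>T. ?Z \<sigma>) \<noteq> {}"
  proof (rule compact_imp_fip_image)
    fix \<sigma>
    show "closed (?Z \<sigma>)"
      by (intro closed_Collect_all closed_Collect_eq continuous_on_product_coordinates continuous_intros)
  next
    fix S assume S: "finite S" "S \<subseteq> T"
    then have "satisfiable TYPE('u) L V S"
      using assms(5) unfolding finitely_satisfiable_def by simp
    then obtain M :: "('f, 'p, 'u) struct" where
      M: "is_structure L V M" and sat: "\<And>\<sigma>. \<sigma> \<in> S \<Longrightarrow> satisfies M \<sigma>"
      unfolding satisfiable_def by (elim exE conjE) simp
    \<comment> \<open>The same element \<open>c\<close> serves as default for totalized functions
      and for meaningless codes.\<close>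
    obtain c where c: "c \<in> univ M"
      using M by (auto simp: is_structure_def)
    let ?N = "totalize V c M"
    let ?F = "structure_valuation ?N c"
    have N: "total_structure V ?N"
      using M c V(2) by (rule total_structure_totalize)
    have in_univ: "range (decode ?N c \<circ> e) \<subseteq> univ M" for e
      using decode_in_univ(1)[OF N] c by (auto simp: totalize_sel)
    have "?F i \<in> V" for i
    proof (cases i)
      case (Pair \<phi> e)
      have "fm_val ?N (decode ?N c \<circ> e) \<phi> \<in> V"
        by (rule fm_val_in_truth_values[OF N assms(1) \<open>closed V\<close>]) (simp only: totalize_sel in_univ)
      then show ?thesis
        by (simp only: Pair structure_valuation_def prod.case)
    qed
    moreover have "henkin ?F"
      using N assms(1) \<open>closed V\<close> c by (intro henkin_structure_valuation) (simp_all add: totalize_sel)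
    moreover have "?F (\<sigma>, e) = 0" if "\<sigma> \<in> S" for \<sigma> e
    proof -
      \<comment> \<open>Well-formedness guarantees that passing from \<open>M\<close> to
        \<open>?N\<close> leaves the value of \<sigma> unchanged.\<close>
      have "wf_fm L \<sigma>"
        using that S(2) assms(4) by (auto simp: is_theory_def is_sentence_def)
      with fm_val_totalize[OF M in_univ] have "?F (\<sigma>, e) = fm_val M (decode ?N c \<circ> e) \<sigma>"
        by (simp only: structure_valuation_def prod.case)
      also have "\<dots> = 0"
        using sat[OF that] in_univ unfolding satisfies_def by (elim allE impE)
      finally show ?thesis .
    qed
    ultimately have "?F \<in> ?H \<inter> (\<Inter>\<sigma>\<in>S. ?Z \<sigma>)"
      by simp
    then show "?H \<inter> (\<Inter>\<sigma>\<in>S. ?Z \<sigma>) \<noteq> {}"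
      by (metis emptyE)
  qed
  then obtain F where "F \<in> ?H \<inter> (\<Inter>\<sigma>\<in>T. ?Z \<sigma>)"
    by (meson ex_in_conv)
  then have F: "\<And>i. F i \<in> V" "henkin F" "\<And>\<sigma> e. \<sigma> \<in> T \<Longrightarrow> F (\<sigma>, e) = 0"
    by (simp_all del: split_paired_All)
  \<comment> \<open>All codes belong to the universe, so only the predicate values need checking,
    and these are coordinates of \<open>F\<close>.\<close>
  have "is_structure L V (valuation_structure F)"
    using F(1) by (simp add: is_structure_def valuation_structure_def)
  moreover have "satisfies (valuation_structure F) \<sigma>" if "\<sigma> \<in> T" for \<sigma>
    using F(3)[OF that] by (simp add: satisfies_def henkin.fm_val_valuation_structure[OF F(2)])
  ultimately show ?thesis
    unfolding satisfiable_def by blast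
qed

end
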